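(* Let $1<p<\infty$, $p^{-1}+q^{-1}=1$, $\mathbb{U}=L^p(-1,1)$, and $\mathbb{V}=W^{1,q}_{0,\{1\}}(-1,1)$ with norm $\|v\|_{\mathbb{V}}=\|v'\|_q$. Let $B:\mathbb{U}\to\mathbb{V}^*$ be defined by $$\langle Bw,v\rangle_{\mathbb{V}^*,\mathbb{V}}=-\int_{-1}^1 w\,v'.$$ Consider the family of discrete pairs $(\mathbb{U}_n,\mathbb{V}_m)$ with $\mathbb{U}_n\subseteq\mathbb{P}^1_{\mathrm{cont}}(\mathcal{T}_n)$ and $\mathbb{V}\supset\mathbb{V}_m\supseteq\mathbb{P}^k_{\mathrm{cont},0,\{1\}}(\mathcal{T}_n)$, where $\mathcal{T}_n$ is any finite partition of $(-1,1)$ into subintervals. If $k\ge2$, then the Fortin condition holds for $B$: there exists a constant $C_\Pi>0$, independent of $n$ and $m$, such that for each such pair there is an operator $\Pi:\mathbb{V}\to\mathbb{V}_m$ with $$\|\Pi v\|_{\mathbb{V}}\le C_\Pi\|v\|_{\mathbb{V}}\quad\forall v\in\mathbb{V},\qquad \langle Bw_n,v-\Pi v\rangle_{\mathbb{V}^*,\mathbb{V}}=0\quad\forall w_n\in\mathbb{U}_n,\ \forall v\in\mathbb{V}.$$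
   Context: $W^{1,q}_{0,\{1\}}(-1,1)=\{v\in W^{1,q}(-1,1):v(1)=0\}$. For a partition $\mathcal{T}_n$ of $(-1,1)$ into subintervals $T$: $\mathbb{P}^1_{\mathrm{cont}}(\mathcal{T}_n)=\{w\in C^0[-1,1]: w|_T\in\mathbb{P}^1(T)\ \forall T\in\mathcal{T}_n\}$ and $\mathbb{P}^k_{\mathrm{cont},0,\{1\}}(\mathcal{T}_n)=\{\phi\in C^0[-1,1]:\phi|_T\in\mathbb{P}^k(T)\ \forall T\in\mathcal{T}_n,\ \phi(1)=0\}$, where $\mathbb{P}^k(T)$ is the space of polynomials of degree at most $k$ on $T$. $\mathbb{U}_n\subset\mathbb{U}$ and $\mathbb{V}_m\subset\mathbb{V}$ are finite-dimensional subspaces. *)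

theory Defs
  imports
    "HOL-Analysis.Analysis"
    "HOL-Library.Function_Algebras"
    "HOL-Computational_Algebra.Polynomial"
begin

text \<open>The pointwise real vector space structure on functions; it supplies the notions
  \<^verbatim>\<open>fn.subspace\<close> and \<^verbatim>\<open>fn.span\<close>.\<close>

definition fscale :: "real \<Rightarrow> (real \<Rightarrow> real) \<Rightarrow> real \<Rightarrow> real" where
  "fscale c f = (\<lambda>x. c * f x)"

interpretation fn: vector_space fscale
  by unfold_locales (auto simp: fscale_def fun_eq_iff algebra_simps)

definition fin_dim_subspace :: "(real \<Rightarrow> real) set \<Rightarrow> bool" where
  "fin_dim_subspace W \<longleftrightarrow> fn.subspace W \<and> (\<exists>S. finite S \<and> W = fn.span S)"

text \<open>Elements of \<open>L\<^sup>p(-1,1)\<close> are represented by functions on the real line of which only the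
  values on \<open>(-1,1)\<close>, up to a null set, matter.\<close>

abbreviation Om :: "real measure" where
  "Om \<equiv> lebesgue_on {-1<..<1}"

definition Lp :: "real \<Rightarrow> (real \<Rightarrow> real) set" where
  "Lp p = {w \<in> borel_measurable Om. integrable Om (\<lambda>x. \<bar>w x\<bar> powr p)}"

definition Lp_norm :: "real \<Rightarrow> (real \<Rightarrow> real) \<Rightarrow> real" where
  "Lp_norm p w = (LINT x|Om. \<bar>w x\<bar> powr p) powr (1 / p)"

definition test_function :: "(real \<Rightarrow> real) \<Rightarrow> bool" where
  "test_function \<phi> \<longleftrightarrow> \<phi> C1_differentiable_on UNIV \<and>
     (\<exists>K. compact K \<and> K \<subseteq> {-1<..<1} \<and> (\<forall>x. x \<notin> K \<longrightarrow> \<phi> x = 0))"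

definition has_weak_deriv :: "(real \<Rightarrow> real) \<Rightarrow> (real \<Rightarrow> real) \<Rightarrow> bool" where
  "has_weak_deriv v g \<longleftrightarrow> integrable Om v \<and> integrable Om g \<and>
     (\<forall>\<phi>. test_function \<phi> \<longrightarrow>
        (LINT x|Om. v x * deriv \<phi> x) = - (LINT x|Om. g x * \<phi> x))"

text \<open>Weak derivatives are unique up to null sets, so the choice is immaterial for every
  integral formed with it.\<close>

definition weak_deriv :: "(real \<Rightarrow> real) \<Rightarrow> real \<Rightarrow> real" where
  "weak_deriv v = (SOME g. has_weak_deriv v g)"

definition W1 :: "real \<Rightarrow> (real \<Rightarrow> real) set" where
  "W1 q = {v \<in> Lp q. \<exists>g \<in> Lp q. has_weak_deriv v g}"

text \<open>Every class in \<open>W\<^sup>1\<^sup>,\<^sup>q(-1,1)\<close> has exactly one representative that is continuous on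
  \<open>[-1,1]\<close>, and the boundary value \<open>v(1)\<close> refers to it.  Here each class is represented by this
  function, extended by zero off \<open>[-1,1]\<close>.  Fixing the values off \<open>[-1,1]\<close> makes
  representatives unique as functions on the real line, so that finite dimension and
  linearity below mean the same as for the function space itself.\<close>

definition C0 :: "(real \<Rightarrow> real) set" where
  "C0 = {v. continuous_on {-1..1} v \<and> (\<forall>x. x \<notin> {-1..1} \<longrightarrow> v x = 0)}"

definition V_space :: "real \<Rightarrow> (real \<Rightarrow> real) set" where
  "V_space q = {v \<in> W1 q. v \<in> C0 \<and> v 1 = 0}"

definition V_norm :: "real \<Rightarrow> (real \<Rightarrow> real) \<Rightarrow> real" where
  "V_norm q v = Lp_norm q (weak_deriv v)"

text \<open>\<open>B_op w v\<close> is the duality pairing of \<open>B w\<close> with \<open>v\<close>.\<close>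

definition B_op :: "(real \<Rightarrow> real) \<Rightarrow> (real \<Rightarrow> real) \<Rightarrow> real" where
  "B_op w v = - (LINT x|Om. w x * weak_deriv v x)"

text \<open>The elements of a partition are taken closed (they share endpoints); for continuous
  piecewise polynomials this is the same as taking open or half-open subintervals.\<close>

definition is_partition :: "real set set \<Rightarrow> bool" where
  "is_partition \<T> \<longleftrightarrow> \<T> division_of {-1..1} \<and> (\<forall>T\<in>\<T>. interior T \<noteq> {})"

definition P_cont :: "nat \<Rightarrow> real set set \<Rightarrow> (real \<Rightarrow> real) set" where
  "P_cont k \<T> = {w \<in> C0. \<forall>T\<in>\<T>. \<exists>P. degree P \<le> k \<and> (\<forall>x\<in>T. w x = poly P x)}"

definition P_cont0 :: "nat \<Rightarrow> real set set \<Rightarrow> (real \<Rightarrow> real) set" where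
  "P_cont0 k \<T> = {\<phi> \<in> P_cont k \<T>. \<phi> 1 = 0}"

definition discrete_pair ::
  "real \<Rightarrow> real \<Rightarrow> nat \<Rightarrow> (real \<Rightarrow> real) set \<Rightarrow> (real \<Rightarrow> real) set \<Rightarrow> bool" where
  "discrete_pair p q k U\<^sub>n V\<^sub>m \<longleftrightarrow>
     fin_dim_subspace U\<^sub>n \<and> U\<^sub>n \<subseteq> Lp p \<and> fin_dim_subspace V\<^sub>m \<and> V\<^sub>m \<subseteq> V_space q \<and>
     (\<exists>\<T>. is_partition \<T> \<and> U\<^sub>n \<subseteq> P_cont 1 \<T> \<and> P_cont0 k \<T> \<subseteq> V\<^sub>m)"

definition linear_map_on ::
  "(real \<Rightarrow> real) set \<Rightarrow> (real \<Rightarrow> real) set \<Rightarrow> ((real \<Rightarrow> real) \<Rightarrow> real \<Rightarrow> real) \<Rightarrow> bool" where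
  "linear_map_on V W F \<longleftrightarrow> F ` V \<subseteq> W \<and>
     (\<forall>u\<in>V. \<forall>v\<in>V. F (u + v) = F u + F v) \<and> (\<forall>c. \<forall>v\<in>V. F (fscale c v) = fscale c (F v))"

end

theory Submission
  imports Defs
begin

text \<open>On each element \<open>T = [a,b]\<close> of the partition let \<open>\<Pi> v\<close> be the quadratic polynomial with the
  same values as \<open>v\<close> at \<open>a\<close> and \<open>b\<close> and the same integral over \<open>[a,b]\<close>.  Since the pieces
  interpolate \<open>v\<close> at the nodes they fit together continuously, and \<open>\<Pi> v\<close> vanishes at 1 with
  \<open>v\<close>; this is why degree 2 suffices.

  Write \<open>e = v - \<Pi> v\<close>.  On every element \<open>\<integral> e' = 0\<close>, because \<open>e\<close> vanishes at both
  endpoints, and \<open>\<integral> x e' = [x e] - \<integral> e = 0\<close>.  Hence \<open>e'\<close> is orthogonal to every piecewise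
  affine function (\<open>B_op_quad_proj_eq_0\<close>).  In other words, \<open>(\<Pi> v)'\<close> is the \<open>L\<^sup>2\<close>-projection
  of \<open>v'\<close> to the affine functions, element by element.

  The projection is bounded in \<open>L\<^sup>q\<close> with a constant that does not depend on the element: both
  coefficients of \<open>(\<Pi> v)'\<close> are moments of \<open>v'\<close>, which gives
  \<open>\<bar>(\<Pi> v)'\<bar> \<le> 4/(b-a) \<integral>\<^sub>T \<bar>v'\<bar>\<close> on \<open>T\<close> (\<open>abs_quad_slope_le\<close>), and the power mean inequality
  turns this into \<open>\<integral>\<^sub>T \<bar>(\<Pi> v)'\<bar>\<^sup>q \<le> 4\<^sup>q \<integral>\<^sub>T \<bar>v'\<bar>\<^sup>q\<close>.  Summation over the elements yields the
  bound with constant 4.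

  All of this rests on three facts about weak derivatives of continuous functions: the
  fundamental theorem of calculus (\<open>weak_ftc\<close>), the product rule (\<open>has_weak_deriv_mult_C1\<close>),
  which together give the integration by parts above (\<open>weak_first_moment\<close>), and uniqueness up to
  null sets (\<open>weak_deriv_ae_eq\<close>).  The operator is defined through values and integrals of \<open>v\<close>
  rather than through \<open>v'\<close>, so that it is linear on the nose and not merely almost everywhere.\<close>

section \<open>Integration over the open interval and its closure\<close>

lemma integrable_Om_iff:
  fixes f :: "real \<Rightarrow> real"
  shows "integrable Om f \<longleftrightarrow> f absolutely_integrable_on {-1..1}"
proof -
  have "integrable Om f \<longleftrightarrow> f absolutely_integrable_on {-1<..<1}"
    by (simp add: integrable_restrict_space set_integrable_def)
  also have "\<dots> \<longleftrightarrow> f absolutely_integrable_on {-1..1}"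
    using absolutely_integrable_on_open_interval[where f = f and a = "-1" and b = 1] by simp
  finally show ?thesis .
qed

lemma lebesgue_integral_Om:
  fixes f :: "real \<Rightarrow> real"
  assumes "integrable Om f"
  shows "integral\<^sup>L Om f = integral {-1..1} f"
  using lebesgue_integral_eq_integral[OF assms] integral_open_interval_real[of "-1" 1 f] by simp

lemma measurable_Om_if_continuous:
  fixes c :: "real \<Rightarrow> real"
  assumes "continuous_on {-1..1} c"
  shows "c \<in> borel_measurable Om"
  by (rule continuous_imp_measurable_on_sets_lebesgue)
     (auto intro: continuous_on_subset[OF assms])

lemma integrable_Om_continuous_mult:
  fixes c f :: "real \<Rightarrow> real"
  assumes c: "continuous_on {-1..1} c" and f: "integrable Om f"
  shows "integrable Om (\<lambda>x. c x * f x)"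
proof -
  have "bounded (c ` {-1..1})"
    using c compact_continuous_image compact_imp_bounded compact_Icc by blast
  moreover have "c \<in> borel_measurable (lebesgue_on {-1..1})"
    by (rule continuous_imp_measurable_on_sets_lebesgue[OF c]) auto
  ultimately show ?thesis
    using f unfolding integrable_Om_iff
    by (intro absolutely_integrable_bounded_measurable_product_real) auto
qed

lemma integrable_Om_mult_continuous:
  fixes c f :: "real \<Rightarrow> real"
  assumes "integrable Om f" and "continuous_on {-1..1} c"
  shows "integrable Om (\<lambda>x. f x * c x)"
  using integrable_Om_continuous_mult[OF assms(2,1)] by (simp add: mult.commute)

section \<open>Functions with vanishing interval integrals\<close>

text \<open>The sets over which the integral vanishes form a Dynkin system, and the half-lines form an
  intersection-stable generator of the Borel sets.  As that argument lives on Borel sets, \<open>f\<close>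
  is first replaced by a Borel function that agrees with it almost everywhere.\<close>

lemma negligible_nonzero_if_integrals_zero:
  fixes f :: "real \<Rightarrow> real"
  assumes f: "f absolutely_integrable_on {a..b}"
    and zero: "\<And>x. x \<in> {a..b} \<Longrightarrow> integral {a..x} f = 0"
  shows "negligible {x \<in> {a..b}. f x \<noteq> 0}"
proof (cases "a \<le> b")
  case True
  define F where "F x = indicator {a..b} x * f x" for x
  have Fint: "integrable lebesgue F"
    using f by (simp add: set_integrable_def F_def[abs_def])
  then obtain G where G[measurable]: "G \<in> borel_measurable lborel" and FG: "AE x in lborel. F x = G x"
    using completion_ex_borel_measurable_real by blast
  have FG': "AE x in lebesgue. F x = G x"
    using AE_completion[OF FG] .
  have "integrable lebesgue G"
    using Fint FG' integrable_cong_AE[of F lebesgue G] measurable_completion[OF G] by blast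
  then have Gint: "integrable lborel G"
    by (simp add: integrable_completion)
  have Giic: "(LINT y:{..x}|lborel. G y) = integral ({..x} \<inter> {a..b}) f" for x
  proof -
    have "(LINT y:{..x}|lborel. G y) = (LINT y:{..x}|lebesgue. G y)"
      unfolding set_lebesgue_integral_def by (rule integral_completion[symmetric]) simp
    also have "\<dots> = (LINT y:{..x}|lebesgue. F y)"
      unfolding set_lebesgue_integral_def
    proof (rule integral_cong_AE)
      show "(\<lambda>y. indicat_real {..x} y *\<^sub>R G y) \<in> borel_measurable lebesgue"
        by (rule measurable_completion) simp
      show "(\<lambda>y. indicat_real {..x} y *\<^sub>R F y) \<in> borel_measurable lebesgue"
        using Fint by (intro borel_measurable_scaleR borel_measurable_indicator) (auto intro: borel_measurable_integrable)
      show "AE y in lebesgue. indicat_real {..x} y *\<^sub>R G y = indicat_real {..x} y *\<^sub>R F y"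
        using FG' by eventually_elim simp
    qed
    also have "\<dots> = (LINT y:{..x} \<inter> {a..b}|lebesgue. f y)"
      unfolding set_lebesgue_integral_def F_def
      by (rule Bochner_Integration.integral_cong) (auto simp: indicator_def)
    also have "\<dots> = integral ({..x} \<inter> {a..b}) f"
      by (rule set_lebesgue_integral_eq_integral, rule set_integrable_subset[OF f]) auto
    finally show ?thesis .
  qed
  have Giic0: "(LINT y:{..x}|lborel. G y) = 0" for x
  proof -
    consider "x < a" | "x \<in> {a..b}" | "x > b" by fastforce
    then show ?thesis
    proof cases
      case 1 then have eq: "{..x} \<inter> {a..b} = {}" by auto
      show ?thesis unfolding Giic eq by simp
    next
      case 2 then have eq: "{..x} \<inter> {a..b} = {a..x}" by auto
      show ?thesis unfolding Giic eq using zero[OF 2] .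
    next
      case 3 then have eq: "{..x} \<inter> {a..b} = {a..b}" by auto
      show ?thesis unfolding Giic eq using zero[of b] True by simp
    qed
  qed
  have Gtot: "(LINT y|lborel. G y) = 0"
  proof -
    have "((\<lambda>x. LINT y:{..x}|lborel. G y) \<longlongrightarrow> (LINT y|lborel. G y)) at_top"
      unfolding set_lebesgue_integral_def by (rule tendsto_integral_at_top[OF _ Gint]) auto
    then show ?thesis
      by (simp add: Giic0 tendsto_const_iff)
  qed
  have "(LINT x:S|lborel. G x) = 0" if "S \<in> sets borel" for S
  proof -
    have S: "S \<in> sigma_sets UNIV (range (\<lambda>a::real. {..a}))"
      using that by (subst (asm) borel_eq_atMost) simp
    have sub: "sigma_sets UNIV (range (\<lambda>a::real. {..a})) = sets borel"
      by (subst borel_eq_atMost) simp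
    have stable: "Int_stable (range (\<lambda>a::real. {..a}))"
      by (auto simp: Int_stable_def)
    have "range (\<lambda>a::real. {..a}) \<subseteq> Pow UNIV" by simp
    from stable this S show ?thesis
    proof (induction rule: sigma_sets_induct_disjoint)
      case (basic A) then show ?case using Giic0 by auto
    next
      case empty show ?case by (simp add: set_lebesgue_integral_def)
    next
      case (compl A)
      then have [measurable]: "A \<in> sets borel" using sub by simp
      have "(LINT x:UNIV - A|lborel. G x) = (LINT x|lborel. G x - indicator A x *\<^sub>R G x)"
        unfolding set_lebesgue_integral_def
        by (rule Bochner_Integration.integral_cong) (auto simp: indicator_def)
      also have "\<dots> = (LINT x|lborel. G x) - (LINT x:A|lborel. G x)"
        unfolding set_lebesgue_integral_def
        by (intro Bochner_Integration.integral_diff Gint integrable_mult_indicator) simp_all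
      finally show ?case using compl Gtot by simp
    next
      case (union A)
      then have m: "A i \<in> sets lborel" for i using sub by auto
      have "(LINT x:(\<Union>i. A i)|lborel. G x) = (\<Sum>i. LINT x:A i|lborel. G x)"
      proof (rule lebesgue_integral_countable_add)
        show "set_integrable lborel (\<Union>i. A i) G"
          unfolding set_integrable_def using m by (intro integrable_mult_indicator Gint) auto
      qed (use m union in \<open>auto simp: disjoint_family_on_def\<close>)
      then show ?case using union by simp
    qed
  qed
  then have "AE x in lborel. G x = 0"
    using density_unique_real[OF Gint, of "\<lambda>_. 0"] by simp
  with FG have "AE x in lborel. F x = 0"
    by eventually_elim simp
  from AE_completion[OF this] obtain N where "N \<in> null_sets lebesgue" "{x. F x \<noteq> 0} \<subseteq> N"
    unfolding eventually_ae_filter by auto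
  then have "negligible {x. F x \<noteq> 0}"
    using negligible_iff_null_sets negligible_subset by blast
  then show ?thesis
    by (rule negligible_subset) (auto simp: F_def)
qed simp

section \<open>Smooth approximations of indicator functions\<close>

lemma test_function_deriv:
  assumes "test_function \<phi>"
  shows "(\<phi> has_real_derivative deriv \<phi> x) (at x)"
  using assms unfolding test_function_def C1_differentiable_on_eq
  by (metis DERIV_deriv_iff_real_differentiable UNIV_I)

lemma continuous_test_function:
  assumes t: "test_function \<phi>"
  shows "continuous_on UNIV \<phi>" "continuous_on UNIV (deriv \<phi>)"
proof -
  show "continuous_on UNIV \<phi>"
    by (rule DERIV_continuous_on) (rule has_field_derivative_at_within[OF test_function_deriv[OF t]])
  obtain D where D: "\<And>x. (\<phi> has_vector_derivative D x) (at x)" "continuous_on UNIV D"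
    using t unfolding test_function_def C1_differentiable_on_def by auto
  then have "deriv \<phi> = D"
    by (intro ext DERIV_imp_deriv) (simp add: has_real_derivative_iff_has_vector_derivative)
  then show "continuous_on UNIV (deriv \<phi>)" using D(2) by simp
qed

text \<open>The antiderivative of the positive part: the simplest building block for continuously
  differentiable functions that are constant on half-lines.\<close>

definition ramp :: "real \<Rightarrow> real" where
  "ramp x = (max 0 x)\<^sup>2 / 2"

lemma ramp_deriv: "(ramp has_real_derivative max 0 x) (at x)"
proof (cases "x = 0")
  case True
  have "((\<lambda>h. (max 0 h)\<^sup>2 / 2 / h) \<longlongrightarrow> 0) (at (0::real))"
  proof (rule Lim_null_comparison)
    show "\<forall>\<^sub>F h in at (0::real). norm ((max 0 h)\<^sup>2 / 2 / h) \<le> \<bar>h\<bar>"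
      by (auto simp: max_def power2_eq_square intro!: always_eventually)
    show "((\<lambda>h. \<bar>h\<bar>) \<longlongrightarrow> 0) (at (0::real))"
      by (rule tendsto_rabs_zero) (rule tendsto_ident_at)
  qed
  then show ?thesis
    by (simp add: DERIV_def ramp_def True)
next
  case False
  show ?thesis
  proof (cases "x > 0")
    case True
    have "((\<lambda>x. x\<^sup>2 / 2) has_real_derivative x) (at x)"
      by (auto intro!: derivative_eq_intros)
    then have "(ramp has_real_derivative x) (at x)"
      by (rule has_field_derivative_transform_within_open[of _ _ _ "{0<..}"])
         (use True in \<open>auto simp: ramp_def\<close>)
    then show ?thesis using True by simp
  next
    case neg: False
    have "((\<lambda>x. 0) has_real_derivative 0) (at x)"
      by (rule DERIV_const)
    then have "(ramp has_real_derivative 0) (at x)"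
      by (rule has_field_derivative_transform_within_open[of _ _ _ "{..<0}"])
         (use neg False in \<open>auto simp: ramp_def\<close>)
    then show ?thesis using neg by simp
  qed
qed

text \<open>The linear B-spline on \<open>[0,2]\<close>; the second difference makes the linear growth cancel.  Its
  antiderivative, defined next as the second difference of \<open>ramp\<close>, climbs from 0 to 1.\<close>

definition hat :: "real \<Rightarrow> real" where
  "hat x = max 0 x - 2 * max 0 (x - 1) + max 0 (x - 2)"

definition smooth_step :: "real \<Rightarrow> real" where
  "smooth_step x = ramp x - 2 * ramp (x - 1) + ramp (x - 2)"

lemma smooth_step_deriv: "(smooth_step has_real_derivative hat x) (at x)"
  unfolding smooth_step_def[abs_def] hat_def
  by (rule derivative_eq_intros DERIV_chain2[OF ramp_deriv] refl | simp)+

lemma hat_nonneg: "0 \<le> hat x"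
  by (simp add: hat_def max_def)

lemma hat_eq_0: "x \<notin> {0..2} \<Longrightarrow> hat x = 0"
  by (auto simp: hat_def max_def)

lemma continuous_hat: "continuous_on S hat"
  unfolding hat_def[abs_def] by (intro continuous_intros)

lemma smooth_step_mono: "x \<le> y \<Longrightarrow> smooth_step x \<le> smooth_step y"
  using smooth_step_deriv hat_nonneg by (meson DERIV_nonneg_imp_nondecreasing)

lemma smooth_step_eq_0: "x \<le> 0 \<Longrightarrow> smooth_step x = 0"
  by (simp add: smooth_step_def ramp_def)

lemma smooth_step_eq_1: "x \<ge> 2 \<Longrightarrow> smooth_step x = 1"
  by (simp add: smooth_step_def ramp_def power2_eq_square field_simps)

lemma smooth_step_bounds: "0 \<le> smooth_step x" "smooth_step x \<le> 1"
  using smooth_step_mono[of "min 0 x" x] smooth_step_eq_0[of "min 0 x"]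
    smooth_step_mono[of x "max 2 x"] smooth_step_eq_1[of "max 2 x"] by auto

lemma scaled_step_deriv:
  "((\<lambda>x. smooth_step (n * (x - c))) has_real_derivative n * hat (n * (x - c))) (at x)"
proof -
  have "((\<lambda>x. n * (x - c)) has_real_derivative n) (at x)"
    by (auto intro!: derivative_eq_intros)
  from DERIV_chain2[OF smooth_step_deriv this] show ?thesis
    by (simp add: mult.commute)
qed

lemma continuous_scaled_step: "continuous_on S (\<lambda>x. smooth_step (n * (x - c)))"
  by (rule DERIV_continuous_on, rule has_field_derivative_at_within[OF scaled_step_deriv])

lemma continuous_scaled_hat: "continuous_on S (\<lambda>x. n * hat (n * (x - c)))"
  by (intro continuous_intros continuous_on_compose2[OF continuous_hat[of UNIV]]) auto

lemma integrable_Om_continuous: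
  fixes f :: "real \<Rightarrow> real"
  assumes "continuous_on {-1..1} f" shows "integrable Om f"
  unfolding integrable_Om_iff using absolutely_integrable_continuous_real[OF assms] .

text \<open>The scaled B-splines are an approximate identity: they are nonnegative, have integral 1, and
  their supports \<open>[c, c + 2/n]\<close> shrink to \<open>c\<close>.\<close>

lemma hat_kernel_tendsto:
  assumes v: "continuous_on {-1..1} v" and c: "-1 < c" "c < 1"
  shows "(\<lambda>n. LINT x|Om. v x * (real n * hat (real n * (x - c)))) \<longlonglongrightarrow> v c"
proof (rule LIMSEQ_I)
  fix e :: real assume "e > 0"
  obtain d where d: "d > 0" and dv: "\<And>x. x \<in> {-1..1} \<Longrightarrow> \<bar>x - c\<bar> < d \<Longrightarrow> \<bar>v x - v c\<bar> < e / 2"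
    using v c \<open>e > 0\<close> unfolding continuous_on_iff dist_real_def
    by (metis atLeastAtMost_iff half_gt_zero less_eq_real_def)
  \<comment> \<open>From \<open>N\<close> on, the support of the kernel lies within distance \<open>d\<close> of \<open>c\<close> and in \<open>[-1,1]\<close>.\<close>
  obtain N :: nat where N: "real N > max (2 / d) (2 / (1 - c))"
    using reals_Archimedean2 by blast
  have "norm ((LINT x|Om. v x * (real n * hat (real n * (x - c)))) - v c) < e" if "n \<ge> N" for n
  proof -
    have n: "real n > 2 / d" "real n > 2 / (1 - c)" using N that by linarith+
    have n0: "real n > 0" using n(1) d by (meson divide_pos_pos less_trans zero_less_numeral)
    have nd: "2 / real n < d" and nc: "2 \<le> real n * (1 - c)"
      using n d c n0 by (simp_all add: field_simps)
    define K where "K x = real n * hat (real n * (x - c))" for x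
    have Kc: "continuous_on {-1..1} K" unfolding K_def by (rule continuous_scaled_hat)
    have K0: "K x \<ge> 0" for x using n0 hat_nonneg by (simp add: K_def)
    have Kz: "K x = 0" if "x \<notin> {c..c + 2 / n}" for x
    proof -
      have "real n * (x - c) \<notin> {0..2}"
        using that n0 by (auto simp: field_simps zero_le_mult_iff)
      then show ?thesis by (simp add: K_def hat_eq_0)
    qed
    have "(K has_integral smooth_step (real n * (1 - c)) - smooth_step (real n * (-1 - c))) {-1..1}"
      unfolding K_def using scaled_step_deriv
      by (intro fundamental_theorem_of_calculus)
         (auto simp: has_real_derivative_iff_has_vector_derivative[symmetric] intro: has_field_derivative_at_within)
    moreover have "real n * (-1 - c) \<le> 0" using n0 c by (simp add: mult_le_0_iff)
    ultimately have K1: "(K has_integral 1) {-1..1}"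
      using smooth_step_eq_1[OF nc] smooth_step_eq_0 by simp
    have vKc: "continuous_on {-1..1} (\<lambda>x. v x * K x)"
      using v Kc by (intro continuous_intros)
    have dc: "continuous_on {-1..1} (\<lambda>x. (v x - v c) * K x)"
      using v Kc by (intro continuous_intros)
    have "(LINT x|Om. v x * K x) - v c = integral {-1..1} (\<lambda>x. v x * K x) - integral {-1..1} (\<lambda>x. v c * K x)"
      using K1 by (simp add: lebesgue_integral_Om integrable_Om_continuous vKc integral_unique)
    also have "\<dots> = integral {-1..1} (\<lambda>x. (v x - v c) * K x)"
      using vKc Kc by (subst integral_diff[symmetric])
        (auto intro!: integrable_continuous_real continuous_intros simp: algebra_simps)
    also have "norm \<dots> \<le> integral {-1..1} (\<lambda>x. e / 2 * K x)"
    proof (rule integral_norm_bound_integral)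
      show "(\<lambda>x. (v x - v c) * K x) integrable_on {-1..1}"
        by (rule integrable_continuous_real[OF dc])
      show "(\<lambda>x. e / 2 * K x) integrable_on {-1..1}"
        using Kc by (intro integrable_continuous_real continuous_intros)
      fix x :: real assume x: "x \<in> {-1..1}"
      show "norm ((v x - v c) * K x) \<le> e / 2 * K x"
      proof (cases "x \<in> {c..c + 2 / n}")
        case True
        then have "\<bar>x - c\<bar> < d" using nd by auto
        from dv[OF x this] have "\<bar>v x - v c\<bar> * K x \<le> e / 2 * K x"
          using K0[of x] by (intro mult_right_mono) auto
        then show ?thesis using K0[of x] by (simp add: abs_mult)
      qed (simp add: Kz)
    qed
    also have "\<dots> = e / 2" using K1 by (simp add: integral_unique)
    finally show ?thesis using \<open>e > 0\<close> unfolding K_def by simp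
  qed
  then show "\<exists>N. \<forall>n\<ge>N. norm ((LINT x|Om. v x * (real n * hat (real n * (x - c)))) - v c) < e"
    by blast
qed

section \<open>Weak derivatives of continuous functions\<close>

text \<open>Test the weak derivative against continuously differentiable functions \<open>\<phi> n\<close> that converge
  boundedly to the indicator of \<open>(a,b]\<close>.  On the right dominated convergence gives the integral
  of \<open>g\<close> over \<open>(a,b]\<close>; on the left \<open>deriv (\<phi> n)\<close> converges to the difference of the point
  masses at \<open>a\<close> and \<open>b\<close>.\<close>

lemma weak_ftc_interior:
  assumes v: "continuous_on {-1..1} v" and vg: "has_weak_deriv v g"
    and ab: "-1 < a" "a < b" "b < 1"
  shows "integral {a..b} g = v b - v a"
proof -
  define \<phi> where "\<phi> n x = smooth_step (real n * (x - a)) - smooth_step (real n * (x - b))" for n x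
  define \<kappa> where "\<kappa> n x = real n * hat (real n * (x - a)) - real n * hat (real n * (x - b))" for n x
  have d\<phi>: "(\<phi> n has_real_derivative \<kappa> n x) (at x)" for n x
    unfolding \<phi>_def \<kappa>_def by (intro DERIV_diff scaled_step_deriv)
  have g: "integrable Om g" using vg by (simp add: has_weak_deriv_def)
  have \<phi>m: "\<phi> n \<in> borel_measurable Om" for n
    unfolding \<phi>_def
    by (intro measurable_Om_if_continuous continuous_on_diff continuous_scaled_step)
  have \<phi>b: "\<bar>\<phi> n x\<bar> \<le> 1" for n x
    using smooth_step_bounds[of "real n * (x - a)"] smooth_step_bounds[of "real n * (x - b)"]
    by (auto simp: \<phi>_def)
  \<comment> \<open>From \<open>N\<close> on, the support \<open>[a, b + 2/n]\<close> of \<open>\<phi> n\<close> lies in \<open>(-1,1)\<close>.\<close>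
  obtain N :: nat where N: "real N > 2 / (1 - b)"
    using reals_Archimedean2 by blast
  have test: "test_function (\<phi> n)" if "n \<ge> N" for n
  proof -
    have n: "real n > 2 / (1 - b)" using N that by linarith
    have n0: "real n > 0" using n ab by (smt (verit) divide_pos_pos)
    have nb: "b + 2 / real n < 1" using n n0 ab by (simp add: field_simps)
    have "\<phi> n x = 0" if "x \<notin> {a..b + 2 / real n}" for x
    proof (cases "x < a")
      case True
      then have "real n * (x - a) \<le> 0" "real n * (x - b) \<le> 0"
        using n0 ab by (simp_all add: mult_le_0_iff)
      then show ?thesis by (simp add: \<phi>_def smooth_step_eq_0)
    next
      case False
      then have "x - b \<ge> 2 / real n" using that by auto
      then have "real n * (x - b) \<ge> 2" using n0 by (simp add: field_simps)
      moreover have "real n * (x - a) \<ge> real n * (x - b)" using n0 ab by simp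
      ultimately show ?thesis by (simp add: \<phi>_def smooth_step_eq_1)
    qed
    moreover have "\<phi> n C1_differentiable_on UNIV"
      unfolding C1_differentiable_on_def
      using d\<phi>[of n]
      by (intro exI[of _ "\<kappa> n"])
         (auto simp: has_real_derivative_iff_has_vector_derivative \<kappa>_def intro!: continuous_on_diff continuous_scaled_hat)
    ultimately show ?thesis
      unfolding test_function_def using ab nb
      by (intro conjI exI[of _ "{a..b + 2 / real n}"]) auto
  qed
  have deriv\<phi>: "deriv (\<phi> n) = \<kappa> n" for n
    using d\<phi> by (auto intro: DERIV_imp_deriv)
  have L1: "(\<lambda>n. LINT x|Om. v x * \<kappa> n x) \<longlonglongrightarrow> v a - v b"
  proof -
    have "v x * \<kappa> n x = v x * (real n * hat (real n * (x - a))) - v x * (real n * hat (real n * (x - b)))" for n x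
      unfolding \<kappa>_def by (rule right_diff_distrib)
    then have "(LINT x|Om. v x * \<kappa> n x) =
      (LINT x|Om. v x * (real n * hat (real n * (x - a)))) - (LINT x|Om. v x * (real n * hat (real n * (x - b))))" for n
      by (simp only:) (intro Bochner_Integration.integral_diff integrable_Om_continuous continuous_on_mult v continuous_scaled_hat)
    then show ?thesis
      using hat_kernel_tendsto[OF v, of a] hat_kernel_tendsto[OF v, of b] ab
      by (simp only:) (intro tendsto_diff; simp)
  qed
  have L2: "(\<lambda>n. LINT x|Om. g x * \<phi> n x) \<longlonglongrightarrow> (LINT x|Om. g x * indicat_real {a<..b} x)"
  proof (rule integral_dominated_convergence[where w = "\<lambda>x. \<bar>g x\<bar>"])
    show "(\<lambda>x. g x * indicat_real {a<..b} x) \<in> borel_measurable Om"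
      by (intro borel_measurable_times borel_measurable_integrable[OF g] borel_measurable_indicator)
         (use ab in \<open>auto simp: sets_restrict_space_iff\<close>)
    show "(\<lambda>x. g x * \<phi> n x) \<in> borel_measurable Om" for n
      by (intro borel_measurable_times borel_measurable_integrable[OF g] \<phi>m)
    show "integrable Om (\<lambda>x. \<bar>g x\<bar>)" using g by simp
    show "AE x in Om. norm (g x * \<phi> n x) \<le> \<bar>g x\<bar>" for n
      using \<phi>b by (auto simp: abs_mult intro!: mult_left_le AE_I2)
    have step_lim: "(\<lambda>n. smooth_step (real n * (x - c))) \<longlonglongrightarrow> indicat_real {c<..} x" for x c
    proof (cases "x > c")
      case True
      obtain M :: nat where "real M > 2 / (x - c)" using reals_Archimedean2 by blast
      then have "real n * (x - c) \<ge> 2" if "n \<ge> M" for n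
        using that True by (smt (verit) divide_less_eq of_nat_mono)
      then have "smooth_step (real n * (x - c)) = 1" if "n \<ge> M" for n
        using that by (intro smooth_step_eq_1)
      then have "\<forall>\<^sub>F n in sequentially. smooth_step (real n * (x - c)) = 1"
        unfolding eventually_sequentially by blast
      then show ?thesis using True
        by (simp add: tendsto_eventually)
    next
      case False
      then have "real n * (x - c) \<le> 0" for n by (simp add: mult_le_0_iff)
      then show ?thesis using False by (simp add: smooth_step_eq_0)
    qed
    show "AE x in Om. (\<lambda>n. g x * \<phi> n x) \<longlonglongrightarrow> g x * indicat_real {a<..b} x"
    proof (rule AE_I2)
      fix x
      have "(\<lambda>n. \<phi> n x) \<longlonglongrightarrow> indicat_real {a<..} x - indicat_real {b<..} x"
        unfolding \<phi>_def by (intro tendsto_diff step_lim)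
      moreover have "indicat_real {a<..} x - indicat_real {b<..} x = indicat_real {a<..b} x"
        using ab by (auto simp: indicator_def)
      ultimately show "(\<lambda>n. g x * \<phi> n x) \<longlonglongrightarrow> g x * indicat_real {a<..b} x"
        by (intro tendsto_mult_left) simp
    qed
  qed
  have "(LINT x|Om. v x * \<kappa> n x) = - (LINT x|Om. g x * \<phi> n x)" if "n \<ge> N" for n
    using vg test[OF that] deriv\<phi> unfolding has_weak_deriv_def by metis
  then have "\<forall>\<^sub>F n in sequentially. (LINT x|Om. v x * \<kappa> n x) = - (LINT x|Om. g x * \<phi> n x)"
    by (auto simp: eventually_sequentially)
  from Lim_transform_eventually[OF L1 this]
  have "v a - v b = - (LINT x|Om. g x * indicat_real {a<..b} x)"
    using tendsto_minus[OF L2] LIMSEQ_unique by blast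
  moreover have "(LINT x|Om. g x * indicat_real {a<..b} x) = integral {a..b} g"
  proof -
    have "(LINT x|Om. g x * indicat_real {a<..b} x) = (LINT x|Om. indicat_real {a<..b} x *\<^sub>R g x)"
      by (simp add: mult.commute)
    also have "\<dots> = integral {-1..1} (\<lambda>x. indicat_real {a<..b} x *\<^sub>R g x)"
      by (rule lebesgue_integral_Om, rule integrable_mult_indicator[OF _ g])
         (use ab in \<open>auto simp: sets_restrict_space_iff\<close>)
    also have "\<dots> = integral {-1..1} (\<lambda>x. if x \<in> {a<..b} then g x else 0)"
      by (rule integral_cong) (auto simp: indicator_def)
    also have "\<dots> = integral {a<..b} g"
      unfolding integral_restrict_Int using ab by (intro arg_cong2[of _ _ _ _ integral]) auto
    also have "\<dots> = integral {a..b} g"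
      by (rule integral_spike_set; rule negligible_subset[OF negligible_sing[of a]]) auto
    finally show ?thesis .
  qed
  ultimately show ?thesis by simp
qed

text \<open>Test functions do not reach the endpoints of \<open>[-1,1]\<close>; there the identity follows from
  the continuity of \<open>v\<close> and of the indefinite integral.\<close>

lemma weak_ftc:
  assumes v: "continuous_on {-1..1} v" and vg: "has_weak_deriv v g"
    and ab: "-1 \<le> a" "a \<le> b" "b \<le> 1"
  shows "(g has_integral v b - v a) {a..b}"
proof -
  have g: "g integrable_on {-1..1}"
    using vg absolutely_integrable_on_def unfolding has_weak_deriv_def integrable_Om_iff by blast
  define E where "E x = integral {-1..x} g - v x" for x
  have cE: "continuous_on {-1..1} E"
    unfolding E_def using g v by (intro continuous_on_diff indefinite_integral_continuous_1)
  have add: "integral {-1..x} g = integral {-1..y} g + integral {y..x} g"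
    if "-1 \<le> y" "y \<le> x" "x \<le> 1" for x y
    using that g by (subst Henstock_Kurzweil_Integration.integral_combine)
      (auto intro: integrable_on_subinterval[OF g])
  have E0: "E x = E 0" if "x \<in> {-1<..<1}" for x
  proof -
    consider "x = 0" | "x < 0" | "x > 0" by linarith
    then show ?thesis
      using that add[of x 0] add[of 0 x] weak_ftc_interior[OF v vg, of x 0] weak_ftc_interior[OF v vg, of 0 x]
      by cases (auto simp: E_def)
  qed
  have "E x = E 0" if "x \<in> {-1..1}" for x
  proof -
    have "continuous_on (closure {-1<..<1}) E" using cE by simp
    then show ?thesis
      using E0 by (rule continuous_constant_on_closure) (use that in simp_all)
  qed
  from this[of a] this[of b] have "E a = E b" using ab by simp
  then have "integral {a..b} g = v b - v a"
    using add[of a b] ab by (simp add: E_def)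
  moreover have "g integrable_on {a..b}"
    using ab by (intro integrable_on_subinterval[OF g]) auto
  ultimately show ?thesis by (simp add: has_integral_iff)
qed

lemma has_weak_deriv_diff:
  assumes u: "has_weak_deriv u f" and v: "has_weak_deriv v g"
  shows "has_weak_deriv (u - v) (f - g)"
  unfolding has_weak_deriv_def
proof (intro conjI allI impI)
  have iu: "integrable Om u" "integrable Om f" "integrable Om v" "integrable Om g"
    using u v by (auto simp: has_weak_deriv_def)
  then show "integrable Om (u - v)" "integrable Om (f - g)"
    by (simp_all add: fun_diff_def)
  fix \<phi> assume t: "test_function \<phi>"
  have c: "continuous_on {-1..1} \<phi>" "continuous_on {-1..1} (deriv \<phi>)"
    using continuous_test_function[OF t] by (auto intro: continuous_on_subset)
  have i: "integrable Om (\<lambda>x. u x * deriv \<phi> x)" "integrable Om (\<lambda>x. v x * deriv \<phi> x)"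
    "integrable Om (\<lambda>x. f x * \<phi> x)" "integrable Om (\<lambda>x. g x * \<phi> x)"
    by (intro integrable_Om_mult_continuous iu c)+
  show "(LINT x|Om. (u - v) x * deriv \<phi> x) = - (LINT x|Om. (f - g) x * \<phi> x)"
    using u v t i by (simp add: has_weak_deriv_def left_diff_distrib)
qed

text \<open>If \<open>\<phi>\<close> is a test function then so is \<open>\<psi> \<phi>\<close>, and
  \<open>v \<psi> \<phi>' = v (\<psi> \<phi>)' - v \<psi>' \<phi>\<close>.\<close>

lemma has_weak_deriv_mult_C1:
  assumes v: "has_weak_deriv v g"
    and \<psi>: "\<And>x. (\<psi> has_real_derivative \<psi>' x) (at x)" and \<psi>': "continuous_on UNIV \<psi>'"
  shows "has_weak_deriv (\<lambda>x. \<psi> x * v x) (\<lambda>x. \<psi> x * g x + \<psi>' x * v x)"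
  unfolding has_weak_deriv_def
proof (intro conjI allI impI)
  have c\<psi>: "continuous_on S \<psi>" "continuous_on S \<psi>'" for S
    using \<psi> \<psi>' DERIV_continuous_on[of S \<psi> \<psi>'] has_field_derivative_at_within
    by (blast intro: continuous_on_subset)+
  have i: "integrable Om v" "integrable Om g"
    using v by (auto simp: has_weak_deriv_def)
  have iv: "integrable Om (\<lambda>x. \<psi> x * v x)" "integrable Om (\<lambda>x. \<psi> x * g x)" "integrable Om (\<lambda>x. \<psi>' x * v x)"
    using i c\<psi> by (auto intro: integrable_Om_continuous_mult)
  then show "integrable Om (\<lambda>x. \<psi> x * v x)" "integrable Om (\<lambda>x. \<psi> x * g x + \<psi>' x * v x)"
    by simp_all
  fix \<phi> assume t: "test_function \<phi>"
  have d\<phi>: "(\<phi> has_real_derivative deriv \<phi> x) (at x)" for x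
    by (rule test_function_deriv[OF t])
  have c: "continuous_on S \<phi>" "continuous_on S (deriv \<phi>)" for S
    using continuous_test_function[OF t] by (auto intro: continuous_on_subset)
  have d: "((\<lambda>x. \<psi> x * \<phi> x) has_real_derivative \<psi>' x * \<phi> x + \<psi> x * deriv \<phi> x) (at x)" for x
    using DERIV_mult[OF \<psi> d\<phi>, of x] by (simp add: algebra_simps)
  then have dd: "deriv (\<lambda>x. \<psi> x * \<phi> x) x = \<psi>' x * \<phi> x + \<psi> x * deriv \<phi> x" for x
    by (rule DERIV_imp_deriv)
  have t': "test_function (\<lambda>x. \<psi> x * \<phi> x)"
  proof -
    have "(\<lambda>x. \<psi> x * \<phi> x) C1_differentiable_on UNIV"
      unfolding C1_differentiable_on_def
      using d c c\<psi>
      by (intro exI[of _ "\<lambda>x. \<psi>' x * \<phi> x + \<psi> x * deriv \<phi> x"])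
         (auto simp: has_real_derivative_iff_has_vector_derivative intro!: continuous_intros)
    then show ?thesis
      using t unfolding test_function_def by force
  qed
  have *: "(LINT x|Om. v x * (\<psi>' x * \<phi> x + \<psi> x * deriv \<phi> x)) = - (LINT x|Om. g x * (\<psi> x * \<phi> x))"
    using v t' unfolding has_weak_deriv_def dd[symmetric] by blast
  have i1: "integrable Om (\<lambda>x. \<psi>' x * v x * \<phi> x)" "integrable Om (\<lambda>x. \<psi> x * v x * deriv \<phi> x)"
      "integrable Om (\<lambda>x. \<psi> x * g x * \<phi> x)"
    by (intro integrable_Om_mult_continuous iv c)+
  have "(LINT x|Om. v x * (\<psi>' x * \<phi> x + \<psi> x * deriv \<phi> x)) =
      (LINT x|Om. \<psi>' x * v x * \<phi> x + \<psi> x * v x * deriv \<phi> x)"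
    by (rule Bochner_Integration.integral_cong) (auto simp: algebra_simps)
  also have "\<dots> = (LINT x|Om. \<psi>' x * v x * \<phi> x) + (LINT x|Om. \<psi> x * v x * deriv \<phi> x)"
    by (rule Bochner_Integration.integral_add) (fact i1)+
  finally have e1: "(LINT x|Om. \<psi> x * v x * deriv \<phi> x) =
      - (LINT x|Om. \<psi> x * g x * \<phi> x) - (LINT x|Om. \<psi>' x * v x * \<phi> x)"
    using * by (simp add: algebra_simps)
  have "(LINT x|Om. (\<psi> x * g x + \<psi>' x * v x) * \<phi> x) = (LINT x|Om. \<psi> x * g x * \<phi> x + \<psi>' x * v x * \<phi> x)"
    by (simp add: distrib_right)
  also have "\<dots> = (LINT x|Om. \<psi> x * g x * \<phi> x) + (LINT x|Om. \<psi>' x * v x * \<phi> x)"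
    by (rule Bochner_Integration.integral_add) (fact i1)+
  finally show "(LINT x|Om. \<psi> x * v x * deriv \<phi> x) = - (LINT x|Om. (\<psi> x * g x + \<psi>' x * v x) * \<phi> x)"
    using e1 by simp
qed

lemma has_weak_deriv_absolutely_integrable:
  assumes "has_weak_deriv v g" "-1 \<le> a" "b \<le> 1"
  shows "g absolutely_integrable_on {a..b}"
proof -
  have "g absolutely_integrable_on {-1..1}"
    using assms(1) by (simp add: has_weak_deriv_def flip: integrable_Om_iff)
  then show ?thesis
    by (rule set_integrable_subset) (use assms in auto)
qed

text \<open>Integration by parts against \<open>x\<close>, as the fundamental theorem for the product \<open>x v(x)\<close>.\<close>

lemma weak_first_moment:
  assumes v: "continuous_on {-1..1} v" "has_weak_deriv v g"
    and ab: "-1 \<le> a" "a \<le> b" "b \<le> 1"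
  shows "((\<lambda>x. x * g x) has_integral b * v b - a * v a - integral {a..b} v) {a..b}"
proof -
  have "has_weak_deriv (\<lambda>x. x * v x) (\<lambda>x. x * g x + 1 * v x)"
    by (rule has_weak_deriv_mult_C1[OF v(2)]) auto
  then have "((\<lambda>x. x * g x + v x) has_integral b * v b - a * v a) {a..b}"
    using ab by (intro weak_ftc continuous_intros v(1)) auto
  moreover have "v integrable_on {a..b}"
    using ab by (intro integrable_continuous_real continuous_on_subset[OF v(1)]) auto
  ultimately have "((\<lambda>x. x * g x + v x - v x) has_integral b * v b - a * v a - integral {a..b} v) {a..b}"
    by (intro has_integral_diff integrable_integral)
  then show ?thesis by simp
qed

text \<open>By the fundamental theorem \<open>g\<close> and \<open>h\<close> have the same indefinite integral on \<open>[a,b]\<close>.  The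
  interval may be a part of \<open>[-1,1]\<close> so that the lemma identifies the weak derivative of a
  piecewise smooth function one piece at a time.\<close>

lemma weak_deriv_ae_eq:
  assumes v: "continuous_on {-1..1} v" "has_weak_deriv v g"
    and ab: "-1 \<le> a" "b \<le> 1"
    and h: "h absolutely_integrable_on {a..b}"
    and hv: "\<And>x. x \<in> {a..b} \<Longrightarrow> (h has_integral v x - v a) {a..x}"
  shows "negligible {x \<in> {a..b}. g x \<noteq> h x}"
proof -
  have g: "g absolutely_integrable_on {a..b}"
    by (rule has_weak_deriv_absolutely_integrable[OF v(2) ab])
  have "negligible {x \<in> {a..b}. g x - h x \<noteq> 0}"
  proof (rule negligible_nonzero_if_integrals_zero)
    show "(\<lambda>x. g x - h x) absolutely_integrable_on {a..b}"
      using g h by (rule set_integral_diff)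
    fix x assume x: "x \<in> {a..b}"
    then have "(g has_integral v x - v a) {a..x}"
      using ab by (intro weak_ftc[OF v]) auto
    from has_integral_diff[OF this hv[OF x]] show "integral {a..x} (\<lambda>x. g x - h x) = 0"
      by (simp add: integral_unique)
  qed
  then show ?thesis by simp
qed

section \<open>The norm of the test space\<close>

lemma V_space_continuous: "v \<in> V_space q \<Longrightarrow> continuous_on {-1..1} v"
  by (simp add: V_space_def C0_def)

lemma has_weak_deriv_weak_deriv: "has_weak_deriv v g \<Longrightarrow> has_weak_deriv v (weak_deriv v)"
  unfolding weak_deriv_def by (rule someI[of "has_weak_deriv v"])

lemma V_space_has_weak_deriv: "v \<in> V_space q \<Longrightarrow> has_weak_deriv v (weak_deriv v)"
  by (auto simp: V_space_def W1_def intro: has_weak_deriv_weak_deriv)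

text \<open>Membership in the space provides some weak derivative in \<open>L\<^sup>q\<close>; uniqueness passes this on to the
  chosen one.\<close>

lemma V_space_weak_deriv_powr_integrable:
  assumes v: "v \<in> V_space q"
  shows "integrable Om (\<lambda>x. \<bar>weak_deriv v x\<bar> powr q)"
proof -
  obtain g where g: "g \<in> Lp q" "has_weak_deriv v g"
    using v by (auto simp: V_space_def W1_def)
  note cont = V_space_continuous[OF v]
  have "negligible {x \<in> {-1..1}. weak_deriv v x \<noteq> g x}"
    by (rule weak_deriv_ae_eq[OF cont V_space_has_weak_deriv[OF v]])
       (auto intro: has_weak_deriv_absolutely_integrable[OF g(2)] weak_ftc[OF cont g(2)])
  moreover have "(\<lambda>x. \<bar>g x\<bar> powr q) absolutely_integrable_on {-1..1}"
    using g(1) by (simp add: Lp_def flip: integrable_Om_iff)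
  ultimately have "(\<lambda>x. \<bar>weak_deriv v x\<bar> powr q) absolutely_integrable_on {-1..1}"
    by (subst (asm) absolutely_integrable_spike_eq[where g = "\<lambda>x. \<bar>weak_deriv v x\<bar> powr q"]) auto
  then show ?thesis by (simp add: integrable_Om_iff)
qed

lemma V_norm_eq:
  assumes "v \<in> V_space q"
  shows "V_norm q v = integral {-1..1} (\<lambda>x. \<bar>weak_deriv v x\<bar> powr q) powr (1 / q)"
  unfolding V_norm_def Lp_norm_def
  using lebesgue_integral_Om[OF V_space_weak_deriv_powr_integrable[OF assms]] by simp

section \<open>The power mean inequality\<close>

text \<open>The convex function \<open>s\<^sup>q\<close> lies above its tangent at \<open>c\<close>; this is Young's inequality for
  \<open>s\<close> and \<open>c powr (q - 1)\<close>.\<close>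

lemma powr_ge_tangent:
  fixes q s c :: real
  assumes q: "1 < q" and "0 \<le> s" "0 \<le> c"
  shows "c powr q + q * c powr (q - 1) * (s - c) \<le> s powr q"
proof -
  define p where "p = q / (q - 1)"
  have p: "1 < p" "1 / q + 1 / p = 1" using q by (auto simp: p_def field_simps)
  have "s * c powr (q - 1) \<le> s powr q / q + (c powr (q - 1)) powr p / p"
    using assms p by (intro Youngs_inequality) auto
  also have "(c powr (q - 1)) powr p = c powr q"
    using q by (simp add: powr_powr p_def)
  finally have "q * (s * c powr (q - 1)) \<le> q * (s powr q / q + c powr q / p)"
    using q by (intro mult_left_mono) auto
  also have "\<dots> = s powr q + (q - 1) * c powr q"
    using q by (simp add: p_def field_simps)
  finally have "q * (s * c powr (q - 1)) \<le> s powr q + (q - 1) * c powr q" .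
  moreover have "c powr (q - 1) * c = c powr q"
    using \<open>0 \<le> c\<close> by (cases "c = 0") (simp_all add: powr_diff)
  then have "q * c powr (q - 1) * (s - c) = q * (s * c powr (q - 1)) - q * c powr q"
    by (simp only: right_diff_distrib mult.assoc mult.commute[of s])
  ultimately show ?thesis by (simp add: left_diff_distrib)
qed

text \<open>Jensen's inequality for \<open>s\<^sup>q\<close>: integrate the tangent inequality at the mean \<open>c\<close> of \<open>\<bar>g\<bar>\<close>,
  where the linear term drops out.\<close>

lemma power_mean_integral:
  fixes g :: "real \<Rightarrow> real"
  assumes q: "1 < q" and ab: "a < b"
    and g: "g absolutely_integrable_on {a..b}"
    and gq: "(\<lambda>x. \<bar>g x\<bar> powr q) integrable_on {a..b}"
  shows "(b - a) * (integral {a..b} (\<lambda>x. \<bar>g x\<bar>) / (b - a)) powr q \<le> integral {a..b} (\<lambda>x. \<bar>g x\<bar> powr q)"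
proof -
  define c where "c = integral {a..b} (\<lambda>x. \<bar>g x\<bar>) / (b - a)"
  have ag: "(\<lambda>x. \<bar>g x\<bar>) integrable_on {a..b}"
    using g unfolding absolutely_integrable_on_def by simp
  have c0: "0 \<le> c" unfolding c_def using ab ag by (simp add: integral_nonneg)
  have "((\<lambda>x. c powr q + q * c powr (q - 1) * (\<bar>g x\<bar> - c)) has_integral
      (b - a) * c powr q + q * c powr (q - 1) * (integral {a..b} (\<lambda>x. \<bar>g x\<bar>) - (b - a) * c)) {a..b}"
    using ab has_integral_const_real[of "c powr q" a b] has_integral_const_real[of c a b]
    by (intro has_integral_add has_integral_mult_right has_integral_diff integrable_integral ag) auto
  moreover have "integral {a..b} (\<lambda>x. \<bar>g x\<bar>) - (b - a) * c = 0"
    using ab by (simp add: c_def)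
  ultimately have "((\<lambda>x. c powr q + q * c powr (q - 1) * (\<bar>g x\<bar> - c)) has_integral (b - a) * c powr q) {a..b}"
    by simp
  from has_integral_le[OF this integrable_integral[OF gq]] show ?thesis
    unfolding c_def[symmetric] using powr_ge_tangent[OF q _ c0] by simp
qed

section \<open>The quadratic fit on one interval\<close>

text \<open>The factor of the bubble \<open>(x-a)(x-b)\<close>.  The affine interpolant of \<open>v\<close> has the integral
  \<open>(b-a)/2 (v a + v b)\<close> and the bubble has \<open>-(b-a)\<^sup>3/6\<close>, so this factor corrects the integral to
  that of \<open>v\<close>.\<close>

definition bubble_coeff :: "real \<Rightarrow> real \<Rightarrow> (real \<Rightarrow> real) \<Rightarrow> real" where
  "bubble_coeff a b v = 6 / (b - a)^3 * ((b - a) / 2 * (v a + v b) - integral {a..b} v)"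

definition quad_fit :: "real \<Rightarrow> real \<Rightarrow> (real \<Rightarrow> real) \<Rightarrow> real poly" where
  "quad_fit a b v = [:v a:] + smult ((v b - v a) / (b - a)) [:-a, 1:]
     + smult (bubble_coeff a b v) ([:-a, 1:] * [:-b, 1:])"

definition quad_slope :: "real \<Rightarrow> real \<Rightarrow> (real \<Rightarrow> real) \<Rightarrow> real \<Rightarrow> real" where
  "quad_slope a b v x = (v b - v a) / (b - a) + bubble_coeff a b v * (2 * x - a - b)"

lemma poly_quad_fit:
  "poly (quad_fit a b v) x =
     v a + (v b - v a) / (b - a) * (x - a) + bubble_coeff a b v * ((x - a) * (x - b))"
proof -
  have "poly ([:d:] + smult s [:-a, 1:] + smult k ([:-a, 1:] * [:-b, 1:])) x
      = d + s * (x - a) + k * ((x - a) * (x - b))" for d s k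
    by (simp add: algebra_simps)
  then show ?thesis unfolding quad_fit_def .
qed

lemma degree_quad_fit: "degree (quad_fit a b v) \<le> 2"
  unfolding quad_fit_def by (intro degree_add_le order.trans[OF degree_smult_le]) auto

lemma quad_fit_endpoints:
  assumes "a < b"
  shows "poly (quad_fit a b v) a = v a" "poly (quad_fit a b v) b = v b"
  using assms by (auto simp: poly_quad_fit)

lemma quad_fit_deriv: "(poly (quad_fit a b v) has_real_derivative quad_slope a b v x) (at x)"
  unfolding poly_quad_fit[abs_def] quad_slope_def
  by (rule derivative_eq_intros refl | simp add: algebra_simps)+

lemma integral_quad_fit:
  assumes "a < b"
  shows "(poly (quad_fit a b v) has_integral integral {a..b} v) {a..b}"
proof -
  define P where "P x = v a * x + (v b - v a) / (b - a) * ((x - a)\<^sup>2 / 2)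
      + bubble_coeff a b v * ((x - a)^3 / 3 - (b - a) * (x - a)\<^sup>2 / 2)" for x
  have "((\<lambda>x. d * x + s * ((x - a)\<^sup>2 / 2) + k * ((x - a)^3 / 3 - (b - a) * (x - a)\<^sup>2 / 2))
      has_real_derivative d + s * (x - a) + k * ((x - a) * (x - b))) (at x)" for d s k x
    by (rule derivative_eq_intros refl | simp)+ (simp add: field_simps power2_eq_square)
  then have "(P has_real_derivative poly (quad_fit a b v) x) (at x)" for x
    unfolding P_def poly_quad_fit by blast
  then have "(poly (quad_fit a b v) has_integral P b - P a) {a..b}"
    using assms by (intro fundamental_theorem_of_calculus)
      (auto simp: has_real_derivative_iff_has_vector_derivative[symmetric] intro: has_field_derivative_at_within)
  also have "P b - P a = integral {a..b} v"
  proof -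
    have "P b - P a = v a * (b - a) + (v b - v a) / (b - a) * ((b - a)\<^sup>2 / 2)
        - bubble_coeff a b v * (b - a)^3 / 6"
    proof -
      have "d * (b - a)^3 / 3 - d * ((b - a) * (b - a)\<^sup>2) / 2 = - (d * (b - a)^3 / 6)" for d
        by (simp add: power2_eq_square power3_eq_cube)
      from this[of "bubble_coeff a b v"] show ?thesis
        by (simp add: P_def right_diff_distrib)
    qed
    also have "(v b - v a) / (b - a) * ((b - a)\<^sup>2 / 2) = (v b - v a) * (b - a) / 2"
      using assms by (simp add: power2_eq_square)
    also have "bubble_coeff a b v * (b - a)^3 = 6 * ((b - a) / 2 * (v a + v b) - integral {a..b} v)"
      using assms by (simp add: bubble_coeff_def)
    finally show ?thesis by argo
  qed
  finally show ?thesis .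
qed

text \<open>With \<open>L = b - a\<close>, the slope is \<open>1/L \<integral> g + 12/L\<^sup>3 M (x - m)\<close>, where \<open>m\<close> is the midpoint and
  \<open>M\<close> is the first moment of \<open>g\<close> about \<open>m\<close>.  The first term contributes 1 to the constant; the
  second contributes 3, because \<open>\<bar>M\<bar> \<le> L/2 \<integral> \<bar>g\<bar>\<close> and \<open>\<bar>x - m\<bar> \<le> L/2\<close>.\<close>

lemma abs_quad_slope_le:
  assumes v: "continuous_on {-1..1} v" "has_weak_deriv v g"
    and ab: "-1 \<le> a" "a < b" "b \<le> 1" and x: "x \<in> {a..b}"
  shows "\<bar>quad_slope a b v x\<bar> \<le> 4 * (integral {a..b} (\<lambda>t. \<bar>g t\<bar>) / (b - a))"
proof -
  define A where "A = integral {a..b} (\<lambda>t. \<bar>g t\<bar>)"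
  define L where "L = b - a"
  have L: "L > 0" using ab by (simp add: L_def)
  have g: "g absolutely_integrable_on {a..b}"
    by (rule has_weak_deriv_absolutely_integrable[OF v(2)]) (use ab in auto)
  then have ag: "(\<lambda>t. \<bar>g t\<bar>) integrable_on {a..b}"
    unfolding absolutely_integrable_on_def by simp
  have i0: "(g has_integral v b - v a) {a..b}"
    by (rule weak_ftc[OF v]) (use ab in auto)
  have i1: "((\<lambda>t. t * g t) has_integral b * v b - a * v a - integral {a..b} v) {a..b}"
    by (rule weak_first_moment[OF v]) (use ab in auto)
  define M where "M = L / 2 * (v a + v b) - integral {a..b} v"
  have "((\<lambda>t. t * g t - (a + b) / 2 * g t) has_integral
      b * v b - a * v a - integral {a..b} v - (a + b) / 2 * (v b - v a)) {a..b}"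
    by (intro has_integral_diff i1 has_integral_mult_right i0)
  moreover have "b * v b - a * v a - integral {a..b} v - (a + b) / 2 * (v b - v a) = M"
    by (simp add: M_def L_def field_simps)
  ultimately have iM: "((\<lambda>t. (t - (a + b) / 2) * g t) has_integral M) {a..b}"
    by (simp add: left_diff_distrib)
  have "norm (integral {a..b} g) \<le> A"
    unfolding A_def by (rule integral_norm_bound_integral) (use i0 ag in auto)
  then have b0: "\<bar>v b - v a\<bar> \<le> A"
    using i0 by (simp add: integral_unique)
  have "norm (integral {a..b} (\<lambda>t. (t - (a + b) / 2) * g t)) \<le> integral {a..b} (\<lambda>t. L / 2 * \<bar>g t\<bar>)"
  proof (rule integral_norm_bound_integral)
    show "(\<lambda>t. (t - (a + b) / 2) * g t) integrable_on {a..b}" using iM by blast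
    show "(\<lambda>t. L / 2 * \<bar>g t\<bar>) integrable_on {a..b}" using ag by (rule integrable_on_mult_right)
    fix t assume "t \<in> {a..b}"
    then have "\<bar>t - (a + b) / 2\<bar> \<le> L / 2" by (auto simp: L_def abs_le_iff field_simps)
    then have "\<bar>t - (a + b) / 2\<bar> * \<bar>g t\<bar> \<le> L / 2 * \<bar>g t\<bar>"
      by (rule mult_right_mono) simp
    then show "norm ((t - (a + b) / 2) * g t) \<le> L / 2 * \<bar>g t\<bar>"
      by (simp only: real_norm_def abs_mult)
  qed
  then have bM: "\<bar>M\<bar> \<le> L / 2 * A"
    using iM by (simp add: integral_unique A_def)
  have A0: "A \<ge> 0" using b0 by linarith
  have "bubble_coeff a b v = 6 / L^3 * M" by (simp add: bubble_coeff_def M_def L_def)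
  then have "\<bar>bubble_coeff a b v * (2 * x - a - b)\<bar> = 6 / L^3 * (\<bar>M\<bar> * \<bar>2 * x - a - b\<bar>)"
    using L by (simp add: abs_mult)
  also have "\<dots> \<le> 6 / L^3 * (L / 2 * A * L)"
    using L A0 bM x by (intro mult_left_mono mult_mono) (auto simp: L_def)
  also have "\<dots> = 3 * (A / L)" using L by (simp add: power3_eq_cube field_simps)
  finally have "\<bar>bubble_coeff a b v * (2 * x - a - b)\<bar> \<le> 3 * (A / L)" .
  moreover have "\<bar>(v b - v a) / L\<bar> \<le> A / L"
    using L b0 by (simp add: abs_divide divide_right_mono)
  ultimately show ?thesis
    unfolding quad_slope_def A_def[symmetric] L_def[symmetric] by linarith
qed

lemma integral_quad_slope_powr_le:
  assumes q: "1 < q" and v: "continuous_on {-1..1} v" "has_weak_deriv v g"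
    and ab: "-1 \<le> a" "a < b" "b \<le> 1"
    and gq: "(\<lambda>x. \<bar>g x\<bar> powr q) integrable_on {a..b}"
  shows "integral {a..b} (\<lambda>x. \<bar>quad_slope a b v x\<bar> powr q)
      \<le> 4 powr q * integral {a..b} (\<lambda>x. \<bar>g x\<bar> powr q)"
proof -
  define c where "c = integral {a..b} (\<lambda>x. \<bar>g x\<bar>) / (b - a)"
  have g: "g absolutely_integrable_on {a..b}"
    by (rule has_weak_deriv_absolutely_integrable[OF v(2)]) (use ab in auto)
  have c0: "0 \<le> c"
    using ab g unfolding c_def absolutely_integrable_on_def by (simp add: integral_nonneg)
  have "integral {a..b} (\<lambda>x. \<bar>quad_slope a b v x\<bar> powr q) \<le> integral {a..b} (\<lambda>x. (4 * c) powr q)"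
  proof (rule integral_le)
    show "(\<lambda>x. \<bar>quad_slope a b v x\<bar> powr q) integrable_on {a..b}"
      unfolding quad_slope_def using q
      by (intro integrable_continuous_real continuous_on_powr' continuous_intros) auto
    fix x assume "x \<in> {a..b}"
    from abs_quad_slope_le[OF v ab this] show "\<bar>quad_slope a b v x\<bar> powr q \<le> (4 * c) powr q"
      using q by (intro powr_mono2) (auto simp: c_def)
  qed auto
  also have "\<dots> = 4 powr q * ((b - a) * c powr q)"
    using ab c0 by (simp add: powr_mult)
  also have "\<dots> \<le> 4 powr q * integral {a..b} (\<lambda>x. \<bar>g x\<bar> powr q)"
    using power_mean_integral[OF q ab(2) g gq] unfolding c_def by (intro mult_left_mono) auto
  finally show ?thesis .
qed

lemma quad_fit_linear:
  assumes "continuous_on {a..b} u" "continuous_on {a..b} v"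
  shows "poly (quad_fit a b (u + v)) x = poly (quad_fit a b u) x + poly (quad_fit a b v) x"
    and "poly (quad_fit a b (fscale c v)) x = c * poly (quad_fit a b v) x"
proof -
  have int_add: "integral {a..b} (u + v) = integral {a..b} u + integral {a..b} v"
    unfolding plus_fun_def
    by (rule integral_add) (auto intro: integrable_continuous_real assms)
  have "k * (l * ((r + r') + (s + s')) - (i + i')) =
      k * (l * (r + s) - i) + k * (l * (r' + s') - i')" for k l r r' s s' i i' :: real
    by (simp add: algebra_simps)
  then have bubble: "bubble_coeff a b (u + v) = bubble_coeff a b u + bubble_coeff a b v"
    unfolding bubble_coeff_def int_add plus_fun_apply .
  have "(r + r') + ((s + s') - (r + r')) / l * y + (k + k') * z =
      (r + (s - r) / l * y + k * z) + (r' + (s' - r') / l * y + k' * z)"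
    for r r' s s' l y k k' z :: real
    by (simp add: add_divide_distrib diff_divide_distrib algebra_simps)
  then show "poly (quad_fit a b (u + v)) x = poly (quad_fit a b u) x + poly (quad_fit a b v) x"
    unfolding poly_quad_fit bubble plus_fun_apply .
  have "k * (l * (c * r + c * s) - c * i) = c * (k * (l * (r + s) - i))" for k l r s i :: real
    by (simp add: algebra_simps)
  moreover have "integral {a..b} (\<lambda>x. c * v x) = c * integral {a..b} v"
    by (rule integral_mult_right)
  ultimately have bubble: "bubble_coeff a b (fscale c v) = c * bubble_coeff a b v"
    unfolding bubble_coeff_def fscale_def by (simp only:)
  have "c * r + (c * s - c * r) / l * y + c * k * z = c * (r + (s - r) / l * y + k * z)"
    for r s l y k z :: real
    by (simp add: diff_divide_distrib algebra_simps)
  then show "poly (quad_fit a b (fscale c v)) x = c * poly (quad_fit a b v) x"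
    unfolding poly_quad_fit bubble unfolding fscale_def .
qed

section \<open>The piecewise quadratic projection\<close>

text \<open>An interior node lies in two elements.  The choice between them is immaterial by \<open>quad_proj_eq\<close>, as
  both fits interpolate \<open>v\<close> there.\<close>

definition quad_proj :: "real set set \<Rightarrow> (real \<Rightarrow> real) \<Rightarrow> real \<Rightarrow> real" where
  "quad_proj \<T> v x = (if x \<in> {-1..1}
     then let T = (SOME T. T \<in> \<T> \<and> x \<in> T) in poly (quad_fit (Inf T) (Sup T) v) x
     else 0)"

lemma quad_proj_outside: "x \<notin> {-1..1} \<Longrightarrow> quad_proj \<T> v x = 0"
  unfolding quad_proj_def by (rule if_not_P)

lemma partition_member:
  assumes P: "is_partition \<T>" and T: "T \<in> \<T>"
  obtains a b where "T = {a..b}" "a < b" "-1 \<le> a" "b \<le> 1"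
proof -
  have div: "\<T> division_of {-1..1}" and ne: "interior T \<noteq> {}"
    using P T by (auto simp: is_partition_def)
  obtain a b where ab: "T = {a..b}"
    using division_ofD(4)[OF div T] by (metis box_real(2))
  with ne have "a < b" by auto
  moreover have "{a..b} \<subseteq> {-1..1}" using division_ofD(2)[OF div T] ab by simp
  ultimately show ?thesis using that ab by auto
qed

lemma partition_cover:
  assumes "is_partition \<T>" "x \<in> {-1..1}"
  shows "\<exists>T. T \<in> \<T> \<and> x \<in> T"
  using assms division_ofD(6) unfolding is_partition_def by blast

text \<open>A point that two different elements share is an endpoint of both, and there each of the two
  fits has the value of \<open>v\<close>.\<close>

lemma quad_proj_eq:
  assumes P: "is_partition \<T>" and T: "{a..b} \<in> \<T>" and x: "x \<in> {a..b}"
  shows "quad_proj \<T> v x = poly (quad_fit a b v) x"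
proof -
  have ab: "a < b" "-1 \<le> a" "b \<le> 1"
  proof -
    obtain a' b' where "{a..b} = {a'..b'}" "a' < b'" "-1 \<le> a'" "b' \<le> 1"
      using partition_member[OF P T] by metis
    then show "a < b" "-1 \<le> a" "b \<le> 1" by (auto simp: Icc_eq_Icc)
  qed
  define S where "S = (SOME T. T \<in> \<T> \<and> x \<in> T)"
  have S: "S \<in> \<T>" "x \<in> S"
    using someI[of "\<lambda>T. T \<in> \<T> \<and> x \<in> T" "{a..b}"] T x by (auto simp: S_def)
  obtain c d where cd: "S = {c..d}" "c < d"
    using partition_member[OF P S(1)] by metis
  have "quad_proj \<T> v x = poly (quad_fit c d v) x"
    using x ab cd by (simp add: quad_proj_def flip: S_def)
  also have "\<dots> = poly (quad_fit a b v) x"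
  proof (cases "S = {a..b}")
    case True
    then show ?thesis using cd ab by (simp add: Icc_eq_Icc)
  next
    case False
    then have "interior {a..b} \<inter> interior S = {}"
      using P T S(1) unfolding is_partition_def by (metis division_ofD(5))
    then have "{a<..<b} \<inter> {c<..<d} = {}" by (simp add: cd)
    moreover have "{a<..<b} \<inter> {c<..<d} = {max a c<..<min b d}" by auto
    ultimately have "min b d \<le> max a c" by (simp add: greaterThanLessThan_empty_iff)
    then have "x = b \<and> x = c \<or> x = a \<and> x = d"
      using x S(2) ab cd by (auto simp: min_def max_def split: if_splits)
    then show ?thesis
      using quad_fit_endpoints[OF ab(1)] quad_fit_endpoints[OF cd(2)] by auto
  qed
  finally show ?thesis .
qed

lemma quad_proj_P_cont0:
  assumes P: "is_partition \<T>" and k: "2 \<le> k" and v1: "v 1 = 0"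
  shows "quad_proj \<T> v \<in> P_cont0 k \<T>"
proof -
  have div: "\<T> division_of {-1..1}" using P by (simp add: is_partition_def)
  have poly: "\<exists>Q. degree Q \<le> k \<and> (\<forall>x\<in>T. quad_proj \<T> v x = poly Q x)" if T: "T \<in> \<T>" for T
  proof -
    obtain a b where ab: "T = {a..b}" using partition_member[OF P T] by metis
    show ?thesis
      using quad_proj_eq[OF P, of a b] T degree_quad_fit[of a b v] k unfolding ab
      by (intro exI[of _ "quad_fit a b v"]) auto
  qed
  have "continuous_on (\<Union>T\<in>\<T>. T) (quad_proj \<T> v)"
  proof (rule continuous_on_closed_Union)
    show "finite \<T>" using div by (rule division_ofD(1))
    fix T assume T: "T \<in> \<T>"
    obtain a b where ab: "T = {a..b}" using partition_member[OF P T] by metis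
    then show "closed T" by simp
    obtain Q where "\<forall>x\<in>T. quad_proj \<T> v x = poly Q x" using poly[OF T] by blast
    then show "continuous_on T (quad_proj \<T> v)"
      by (subst continuous_on_cong[OF refl]) (auto intro: continuous_intros)
  qed
  then have "continuous_on {-1..1} (quad_proj \<T> v)"
    using division_ofD(6)[OF div] by simp
  moreover have "quad_proj \<T> v 1 = 0"
  proof -
    obtain T where T: "T \<in> \<T>" "1 \<in> T" using partition_cover[OF P, of 1] by auto
    obtain a b where ab: "T = {a..b}" "a < b" "b \<le> 1" using partition_member[OF P T(1)] by metis
    then have "b = 1" using T(2) by simp
    then show ?thesis
      using quad_proj_eq[OF P, of a b 1 v] T ab quad_fit_endpoints[OF ab(2), of v] v1 by simp
  qed
  ultimately show ?thesis
    using poly quad_proj_outside unfolding P_cont0_def P_cont_def C0_def by blast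
qed

lemma quad_proj_linear:
  assumes P: "is_partition \<T>" and u: "continuous_on {-1..1} u" and v: "continuous_on {-1..1} v"
  shows "quad_proj \<T> (u + v) = quad_proj \<T> u + quad_proj \<T> v"
    and "quad_proj \<T> (fscale c v) = fscale c (quad_proj \<T> v)"
proof -
  have "quad_proj \<T> (u + v) x = quad_proj \<T> u x + quad_proj \<T> v x \<and>
      quad_proj \<T> (fscale c v) x = c * quad_proj \<T> v x" for x
  proof (cases "x \<in> {-1..1}")
    case True
    then obtain T where T: "T \<in> \<T>" "x \<in> T" using partition_cover[OF P] by blast
    obtain a b where ab: "T = {a..b}" "a < b" "-1 \<le> a" "b \<le> 1"
      using partition_member[OF P T(1)] by metis
    have "continuous_on {a..b} u" "continuous_on {a..b} v"
      by (rule continuous_on_subset[OF u] continuous_on_subset[OF v], use ab in simp)+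
    note lin = quad_fit_linear[OF this]
    have "{a..b} \<in> \<T>" "x \<in> {a..b}" using T ab by auto
    then show ?thesis
      unfolding quad_proj_eq[OF P \<open>{a..b} \<in> \<T>\<close> \<open>x \<in> {a..b}\<close>] lin by simp
  next
    case False
    then show ?thesis by (simp add: quad_proj_outside del: atLeastAtMost_iff)
  qed
  then show "quad_proj \<T> (u + v) = quad_proj \<T> u + quad_proj \<T> v"
    and "quad_proj \<T> (fscale c v) = fscale c (quad_proj \<T> v)"
    by (simp_all add: fun_eq_iff fscale_def)
qed

text \<open>On each element the weak derivative of the projection is almost everywhere the slope of the
  fit, so the local bounds add up.  Taking the root of order \<open>q\<close> turns the factor
  \<open>4 powr q\<close> into 4.\<close>

lemma quad_proj_bounded:
  assumes P: "is_partition \<T>" and q: "1 < q"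
    and v: "v \<in> V_space q" and Fv: "quad_proj \<T> v \<in> V_space q"
  shows "V_norm q (quad_proj \<T> v) \<le> 4 * V_norm q v"
proof -
  have div: "\<T> division_of {-1..1}" using P by (simp add: is_partition_def)
  define g where "g = weak_deriv v"
  define h where "h = weak_deriv (quad_proj \<T> v)"
  note vc = V_space_continuous[OF v] and Fc = V_space_continuous[OF Fv]
  have vg: "has_weak_deriv v g" and Fh: "has_weak_deriv (quad_proj \<T> v) h"
    unfolding g_def h_def by (rule V_space_has_weak_deriv[OF v], rule V_space_has_weak_deriv[OF Fv])
  have int: "(\<lambda>x. \<bar>weak_deriv u x\<bar> powr q) integrable_on {-1..1}" if "u \<in> V_space q" for u
    using V_space_weak_deriv_powr_integrable[OF that]
    unfolding integrable_Om_iff absolutely_integrable_on_def by blast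
  have gi: "(\<lambda>x. \<bar>g x\<bar> powr q) integrable_on {-1..1}" and hi: "(\<lambda>x. \<bar>h x\<bar> powr q) integrable_on {-1..1}"
    unfolding g_def h_def by (intro int v Fv)+
  have loc: "integral T (\<lambda>x. \<bar>h x\<bar> powr q) \<le> 4 powr q * integral T (\<lambda>x. \<bar>g x\<bar> powr q)" if T: "T \<in> \<T>" for T
  proof -
    obtain a b where ab: "T = {a..b}" "a < b" "-1 \<le> a" "b \<le> 1"
      using partition_member[OF P T] by metis
    have slope: "(quad_slope a b v has_integral quad_proj \<T> v x - quad_proj \<T> v a) {a..x}"
      if x: "x \<in> {a..b}" for x
    proof -
      have "(quad_slope a b v has_integral poly (quad_fit a b v) x - poly (quad_fit a b v) a) {a..x}"
        using x quad_fit_deriv by (intro fundamental_theorem_of_calculus)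
          (auto simp: has_real_derivative_iff_has_vector_derivative[symmetric] intro: has_field_derivative_at_within)
      then show ?thesis
        using quad_proj_eq[OF P, of a b] T ab x by simp
    qed
    have "quad_slope a b v absolutely_integrable_on {a..b}"
      unfolding quad_slope_def[abs_def]
      by (intro absolutely_integrable_continuous_real continuous_intros)
    from weak_deriv_ae_eq[OF Fc Fh ab(3,4) this slope]
    have "negligible {x \<in> {a..b}. h x \<noteq> quad_slope a b v x}" .
    then have "integral {a..b} (\<lambda>x. \<bar>h x\<bar> powr q) = integral {a..b} (\<lambda>x. \<bar>quad_slope a b v x\<bar> powr q)"
      by (rule integral_spike) auto
    also have "\<dots> \<le> 4 powr q * integral {a..b} (\<lambda>x. \<bar>g x\<bar> powr q)"
      using ab by (intro integral_quad_slope_powr_le q vc vg integrable_on_subinterval[OF gi]) auto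
    finally show ?thesis by (simp add: ab)
  qed
  have "integral {-1..1} (\<lambda>x. \<bar>h x\<bar> powr q) = (\<Sum>T\<in>\<T>. integral T (\<lambda>x. \<bar>h x\<bar> powr q))"
    by (rule integral_combine_division_topdown[OF hi div])
  also have "\<dots> \<le> (\<Sum>T\<in>\<T>. 4 powr q * integral T (\<lambda>x. \<bar>g x\<bar> powr q))"
    by (rule sum_mono) (rule loc)
  also have "\<dots> = 4 powr q * integral {-1..1} (\<lambda>x. \<bar>g x\<bar> powr q)"
    using integral_combine_division_topdown[OF gi div] by (simp add: sum_distrib_left)
  finally have "integral {-1..1} (\<lambda>x. \<bar>h x\<bar> powr q) powr (1 / q)
      \<le> (4 powr q * integral {-1..1} (\<lambda>x. \<bar>g x\<bar> powr q)) powr (1 / q)"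
    using q hi by (intro powr_mono2) (auto intro: integral_nonneg)
  also have "\<dots> = 4 * integral {-1..1} (\<lambda>x. \<bar>g x\<bar> powr q) powr (1 / q)"
    using q gi by (simp add: powr_mult powr_powr integral_nonneg)
  finally show ?thesis
    using V_norm_eq[OF v] V_norm_eq[OF Fv] by (simp add: g_def h_def)
qed

text \<open>On an element \<open>w = \<alpha> + \<beta> x\<close>, so it suffices that the zeroth and the first moment of the weak
  derivative of \<open>v - quad_proj \<T> v\<close> vanish.  They do, because this difference is zero at both
  endpoints and has integral zero.\<close>

lemma B_op_quad_proj_eq_0:
  assumes P: "is_partition \<T>" and w: "w \<in> P_cont 1 \<T>"
    and v: "v \<in> V_space q" and Fv: "quad_proj \<T> v \<in> V_space q"
  shows "B_op w (v - quad_proj \<T> v) = 0"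
proof -
  have div: "\<T> division_of {-1..1}" using P by (simp add: is_partition_def)
  define e where "e = v - quad_proj \<T> v"
  define D where "D = weak_deriv e"
  have vc: "continuous_on {-1..1} v" and Fc: "continuous_on {-1..1} (quad_proj \<T> v)"
    by (intro V_space_continuous[OF v] V_space_continuous[OF Fv])+
  have ec: "continuous_on {-1..1} e"
    unfolding e_def fun_diff_def by (intro continuous_on_diff vc Fc)
  have eD: "has_weak_deriv e D"
    unfolding D_def e_def
    by (rule has_weak_deriv_weak_deriv,
        rule has_weak_deriv_diff[OF V_space_has_weak_deriv[OF v] V_space_has_weak_deriv[OF Fv]])
  have wc: "continuous_on {-1..1} w" using w by (simp add: P_cont_def C0_def)
  have "integrable Om (\<lambda>x. w x * D x)"
    using eD by (intro integrable_Om_continuous_mult wc) (simp add: has_weak_deriv_def)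
  then have "B_op w e = - integral {-1..1} (\<lambda>x. w x * D x)"
    by (simp add: B_op_def D_def lebesgue_integral_Om)
  moreover have "((\<lambda>x. w x * D x) has_integral (\<Sum>T\<in>\<T>. 0)) {-1..1}"
  proof (rule has_integral_combine_division[OF div])
    fix T assume T: "T \<in> \<T>"
    obtain a b where ab: "T = {a..b}" "a < b" "-1 \<le> a" "b \<le> 1"
      using partition_member[OF P T] by metis
    have F: "quad_proj \<T> v x = poly (quad_fit a b v) x" if "x \<in> {a..b}" for x
      using quad_proj_eq[OF P, of a b x v] T ab that by simp
    have e0: "e a = 0" "e b = 0"
      using F[of a] F[of b] ab quad_fit_endpoints[OF ab(2), of v] by (auto simp: e_def)
    have qi: "(quad_proj \<T> v has_integral integral {a..b} v) {a..b}"
      by (rule has_integral_eq[OF _ integral_quad_fit[OF ab(2)]]) (use F in simp)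
    have vi: "(v has_integral integral {a..b} v) {a..b}"
      using ab by (intro integrable_integral integrable_continuous_real continuous_on_subset[OF vc]) auto
    have ie: "integral {a..b} e = 0"
      using has_integral_diff[OF vi qi] by (simp add: e_def fun_diff_def integral_unique)
    have D0: "(D has_integral 0) {a..b}"
      using weak_ftc[OF ec eD, of a b] ab e0 by simp
    have D1: "((\<lambda>x. x * D x) has_integral 0) {a..b}"
      using weak_first_moment[OF ec eD, of a b] ab e0 ie by simp
    obtain Q where Q: "degree Q \<le> 1" "\<And>x. x \<in> T \<Longrightarrow> w x = poly Q x"
      using w T by (auto simp: P_cont_def)
    have Qx: "poly Q x = coeff Q 0 + coeff Q 1 * x" for x
      using Q(1) by (cases "degree Q = 0") (auto simp: poly_altdef le_Suc_eq coeff_eq_0)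
    have "((\<lambda>x. coeff Q 0 * D x + coeff Q 1 * (x * D x)) has_integral coeff Q 0 * 0 + coeff Q 1 * 0) {a..b}"
      by (intro has_integral_add has_integral_mult_right D0 D1)
    moreover have "coeff Q 0 * D x + coeff Q 1 * (x * D x) = w x * D x" if "x \<in> {a..b}" for x
      using Q(2)[of x] that by (simp add: ab(1) Qx distrib_right)
    ultimately have "((\<lambda>x. w x * D x) has_integral coeff Q 0 * 0 + coeff Q 1 * 0) {a..b}"
      by (rule has_integral_eq[rotated])
    then show "((\<lambda>x. w x * D x) has_integral 0) T"
      by (simp add: ab(1))
  qed
  ultimately show ?thesis
    by (simp add: e_def integral_unique)
qed

section \<open>The Fortin condition\<close>

theorem proposition5p1:
  fixes p q :: real and k :: nat
  assumes "1 < p" and "1 / p + 1 / q = 1" and "k \<ge> 2"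
  shows "\<exists>C>0. \<forall>U\<^sub>n V\<^sub>m. discrete_pair p q k U\<^sub>n V\<^sub>m \<longrightarrow>
    (\<exists>F. linear_map_on (V_space q) V\<^sub>m F \<and>
       (\<forall>v\<in>V_space q. V_norm q (F v) \<le> C * V_norm q v) \<and>
       (\<forall>w\<in>U\<^sub>n. \<forall>v\<in>V_space q. B_op w (v - F v) = 0))"
proof (rule exI[of _ 4], intro conjI allI impI)
  have "1 / q = 1 - 1 / p" "1 / p < 1" "0 < 1 / p" using assms by auto
  then have "0 < 1 / q" "1 / q < 1" by linarith+
  then have q: "1 < q" by (simp only: zero_less_divide_1_iff divide_less_eq_1_pos)
  fix U\<^sub>n V\<^sub>m assume "discrete_pair p q k U\<^sub>n V\<^sub>m"
  then obtain \<T> where P: "is_partition \<T>" and U: "U\<^sub>n \<subseteq> P_cont 1 \<T>"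
    and Vk: "P_cont0 k \<T> \<subseteq> V\<^sub>m" and V: "V\<^sub>m \<subseteq> V_space q"
    by (auto simp: discrete_pair_def)
  have in_Vm: "quad_proj \<T> v \<in> V\<^sub>m" if "v \<in> V_space q" for v
    using quad_proj_P_cont0[OF P \<open>k \<ge> 2\<close>, of v] Vk that by (auto simp: V_space_def)
  show "\<exists>F. linear_map_on (V_space q) V\<^sub>m F \<and>
       (\<forall>v\<in>V_space q. V_norm q (F v) \<le> 4 * V_norm q v) \<and>
       (\<forall>w\<in>U\<^sub>n. \<forall>v\<in>V_space q. B_op w (v - F v) = 0)"
  proof (intro exI[of _ "quad_proj \<T>"] conjI ballI)
    show "linear_map_on (V_space q) V\<^sub>m (quad_proj \<T>)"
      unfolding linear_map_on_def
      using in_Vm quad_proj_linear[OF P] V_space_continuous by blast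
    show "V_norm q (quad_proj \<T> v) \<le> 4 * V_norm q v" if "v \<in> V_space q" for v
      using quad_proj_bounded[OF P q that] in_Vm[OF that] V by blast
    show "B_op w (v - quad_proj \<T> v) = 0" if "w \<in> U\<^sub>n" "v \<in> V_space q" for w v
      using B_op_quad_proj_eq_0[OF P _ that(2)] in_Vm[OF that(2)] V U that(1) by blast
  qed
qed simp

end
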